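(* Let $n\ge 2$. Then $$H_0(K_n)\;\cong\;\mathbb Z\langle e(\sigma_x,\sigma_y,\sigma_z)\mid\sigma_x,\sigma_y,\sigma_z\in\Sigma_{n-1}\rangle/\sim,$$ where the right-hand side is the free abelian group on the top-dimensional cells of $P_n$ modulo identification of generators under $\sim$, and $\sim$ is the equivalence relation on these cells generated by elementary geometric isotopies (that is, generated by $e\sim e'$ whenever there is an elementary geometric isotopy between the representative knots of $e$ and $e'$).
   Context: Homology has integer coefficients. Plumbers' curves. Let $v=(v_1,\dots,v_{n-1})\in((0,1)^3)^{n-1}$. Write $v_i=(v_i^x,v_i^y,v_i^z)$, and by convention $v_0=(0,0,0)$, $v_n=(1,1,1)$. For $0\le i\le n-1$ define three (possibly degenerate) straight segments, called pipes: $\mathbf x_i$ from $(v_i^x,v_i^y,v_i^z)$ to $(v_{i+1}^x,v_i^y,v_i^z)$; $\mathbf y_i$ from $(v_{i+1}^x,v_i^y,v_i^z)$ to $(v_{i+1}^x,v_{i+1}^y,v_i^z)$; $\mathbf z_i$ from $(v_{i+1}^x,v_{i+1}^y,v_i^z)$ to $(v_{i+1}^x,v_{i+1}^y,v_{i+1}^z)$. The $n$-move plumbers' curve $\phi_v$ is the piecewise linear path traversing the pipes linearly in the order $\mathbf x_0,\mathbf y_0,\mathbf z_0,\mathbf x_1,\dots,\mathbf z_{n-1}$. The space $P_n$ of all $\phi_v$ is identified (and topologized) with $((0,1)^3)^{n-1}$ via $v$. Two pipes are distant if, in this ordered sequence, they are separated by at least three intervening pipes. The curve $\phi_v$ is singular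 if the images of some pair of its distant pipes intersect; otherwise it is a plumbers' knot. $K_n\subseteq P_n$ is the subspace of plumbers' knots. Cells. For $\sigma_x,\sigma_y,\sigma_z\in\Sigma_{n-1}$ (symmetric group), $e(\sigma_x,\sigma_y,\sigma_z)\subset P_n$ is the set of $\phi_v$ with $0<v^c_{\sigma_c(1)}<\cdots<v^c_{\sigma_c(n-1)}<1$ for each $c\in\{x,y,z\}$; these are the top-dimensional cells. The representative knot of $e=e(\sigma_x,\sigma_y,\sigma_z)$ is $\phi_{v(e)}$ with $v(e)_i=\left(\frac{\sigma_x^{-1}(i)}n,\frac{\sigma_y^{-1}(i)}n,\frac{\sigma_z^{-1}(i)}n\right)$ for $1\le i\le n-1$. A transposition $\tau$ appears in $\sigma\in\Sigma_{n-1}$ if $\tau=(\sigma(i)\ \sigma(i+1))$ for some $i\in\{1,\dots,n-2\}$. Elementary geometric isotopies. Let $c\in\{x,y,z\}$, let $\tau$ be a transposition appearing in $\sigma_c$, and let $\tau_c\cdot e$ be the cell obtained from $e=e(\sigma_x,\sigma_y,\sigma_z)$ by replacing $\sigma_c$ with $\tau\sigma_c$ (composition, $(\tau\sigma_c)(i)=\tau(\sigma_c(i))$). If the straight-line path $t\mapsto\phi_{(1-t)v(e)+t\,v(\tau_c\cdot e)}$, $t\in[0,1]$, lies entirely in $K_n$, it is called an elementary geometric isotopy from $\phi_{v(e)}$ to $\phi_{v(\tau_c\cdot e)}$. *)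

theory Defs
  imports "HOL-Homology.Homology" "HOL-Algebra.Free_Abelian_Groups"
    "HOL-Algebra.Generated_Groups" "HOL-Combinatorics.Permutations"
begin

text \<open>
  The coordinates x, y, z of a point of \<open>real ^ 3\<close> are its components 1, 2, 3.
  A plumbers' curve \<open>\<phi>\<^sub>v\<close> is represented by its parameter \<open>v\<close>, a function on \<open>{1..<n}\<close>
  (extensional: \<open>undefined\<close> elsewhere) with values in the open unit cube, so that the space
  of curves carries the product topology.
\<close>

definition open_unit_cube :: "(real ^ 3) set" where
  "open_unit_cube = {p. \<forall>c. 0 < p $ c \<and> p $ c < 1}"

definition plumbers_curve_space :: "nat \<Rightarrow> (nat \<Rightarrow> real ^ 3) topology" where
  "plumbers_curve_space n = product_topology (\<lambda>i. top_of_set open_unit_cube) {1..<n}"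

definition vertex :: "nat \<Rightarrow> (nat \<Rightarrow> real ^ 3) \<Rightarrow> nat \<Rightarrow> real ^ 3" where
  "vertex n v i =
     (if i = 0 then vector [0, 0, 0] else if i = n then vector [1, 1, 1] else v i)"

definition x_pipe :: "nat \<Rightarrow> (nat \<Rightarrow> real ^ 3) \<Rightarrow> nat \<Rightarrow> real \<Rightarrow> real ^ 3" where
  "x_pipe n v i =
     (let p = vertex n v i; q = vertex n v (i + 1) in
      linepath (vector [p $ 1, p $ 2, p $ 3]) (vector [q $ 1, p $ 2, p $ 3]))"

definition y_pipe :: "nat \<Rightarrow> (nat \<Rightarrow> real ^ 3) \<Rightarrow> nat \<Rightarrow> real \<Rightarrow> real ^ 3" where
  "y_pipe n v i =
     (let p = vertex n v i; q = vertex n v (i + 1) in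
      linepath (vector [q $ 1, p $ 2, p $ 3]) (vector [q $ 1, q $ 2, p $ 3]))"

definition z_pipe :: "nat \<Rightarrow> (nat \<Rightarrow> real ^ 3) \<Rightarrow> nat \<Rightarrow> real \<Rightarrow> real ^ 3" where
  "z_pipe n v i =
     (let p = vertex n v i; q = vertex n v (i + 1) in
      linepath (vector [q $ 1, q $ 2, p $ 3]) (vector [q $ 1, q $ 2, q $ 3]))"

text \<open>The \<open>k\<close>-th pipe, for \<open>k < 3 * n\<close>, in the order x0, y0, z0, x1, ...\<close>

definition pipe :: "nat \<Rightarrow> (nat \<Rightarrow> real ^ 3) \<Rightarrow> nat \<Rightarrow> real \<Rightarrow> real ^ 3" where
  "pipe n v k =
     (if k mod 3 = 0 then x_pipe n v (k div 3)
      else if k mod 3 = 1 then y_pipe n v (k div 3)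
      else z_pipe n v (k div 3))"

text \<open>Two pipes are distant if at least three pipes lie strictly between them.\<close>

definition distant :: "nat \<Rightarrow> nat \<Rightarrow> bool" where
  "distant j k \<longleftrightarrow> card {min j k<..<max j k} \<ge> 3"

definition singular_curve :: "nat \<Rightarrow> (nat \<Rightarrow> real ^ 3) \<Rightarrow> bool" where
  "singular_curve n v \<longleftrightarrow>
     (\<exists>j<3 * n. \<exists>k<3 * n. distant j k \<and>
        path_image (pipe n v j) \<inter> path_image (pipe n v k) \<noteq> {})"

definition plumbers_knot_space :: "nat \<Rightarrow> (nat \<Rightarrow> real ^ 3) topology" where
  "plumbers_knot_space n =
     subtopology (plumbers_curve_space n) {v. \<not> singular_curve n v}"

text \<open>
  A triple of permutations of \<open>{1..<n}\<close> is a function \<open>\<sigma>\<close> on the three coordinates.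
  The bounds 0 and 1 of the chains of inequalities hold throughout the space of curves.
\<close>

definition perm_triples :: "nat \<Rightarrow> (3 \<Rightarrow> nat \<Rightarrow> nat) set" where
  "perm_triples n = {\<sigma>. \<forall>c. \<sigma> c permutes {1..<n}}"

definition cell :: "nat \<Rightarrow> (3 \<Rightarrow> nat \<Rightarrow> nat) \<Rightarrow> (nat \<Rightarrow> real ^ 3) set" where
  "cell n \<sigma> =
     {v \<in> topspace (plumbers_curve_space n).
        \<forall>c. strict_mono_on {1..<n} (\<lambda>i. v (\<sigma> c i) $ c)}"

definition cells :: "nat \<Rightarrow> (nat \<Rightarrow> real ^ 3) set set" where
  "cells n = cell n ` perm_triples n"

definition representative :: "nat \<Rightarrow> (3 \<Rightarrow> nat \<Rightarrow> nat) \<Rightarrow> nat \<Rightarrow> real ^ 3" where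
  "representative n \<sigma> = (\<lambda>i\<in>{1..<n}. \<chi> c. real (inv_into UNIV (\<sigma> c) i) / real n)"

definition appears_in :: "nat \<Rightarrow> (nat \<Rightarrow> nat) \<Rightarrow> (nat \<Rightarrow> nat) \<Rightarrow> bool" where
  "appears_in n \<tau> s \<longleftrightarrow> (\<exists>i\<in>{1..n - 2}. \<tau> = Transposition.transpose (s i) (s (i + 1)))"

definition straight_line ::
    "nat \<Rightarrow> (nat \<Rightarrow> real ^ 3) \<Rightarrow> (nat \<Rightarrow> real ^ 3) \<Rightarrow> real \<Rightarrow> nat \<Rightarrow> real ^ 3" where
  "straight_line n v w t = (\<lambda>i\<in>{1..<n}. (1 - t) *\<^sub>R v i + t *\<^sub>R w i)"

text \<open>
  There is an elementary geometric isotopy from the representative knot of \<open>e\<close> to that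
  of \<open>e'\<close>.
\<close>

definition elementary_isotopic ::
    "nat \<Rightarrow> (nat \<Rightarrow> real ^ 3) set \<Rightarrow> (nat \<Rightarrow> real ^ 3) set \<Rightarrow> bool" where
  "elementary_isotopic n e e' \<longleftrightarrow>
     (\<exists>\<sigma>\<in>perm_triples n. \<exists>c \<tau>.
        appears_in n \<tau> (\<sigma> c) \<and>
        e = cell n \<sigma> \<and> e' = cell n (\<sigma>(c := \<tau> \<circ> \<sigma> c)) \<and>
        (\<forall>t\<in>{0..1}.
           straight_line n (representative n \<sigma>) (representative n (\<sigma>(c := \<tau> \<circ> \<sigma> c))) t
             \<in> topspace (plumbers_knot_space n)))"

definition free_Abelian_group_modulo ::
    "'a set \<Rightarrow> ('a \<Rightarrow> 'a \<Rightarrow> bool) \<Rightarrow> ('a \<Rightarrow>\<^sub>0 int) set monoid" where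
  "free_Abelian_group_modulo S R =
     free_Abelian_group S Mod
       generate (free_Abelian_group S) {frag_of a - frag_of b | a b. a \<in> S \<and> b \<in> S \<and> R a b}"

end

theory Submission
  imports Defs
begin

text \<open>
  The zeroth homology of \<open>K\<^sub>n\<close> is free on the path components of \<open>K\<^sub>n\<close>, and a free abelian
  group modulo an identification of generators is free on the classes. So it is enough to match
  the equivalence classes of cells with the path components, a cell corresponding to the
  component of its representative knot.

  Pipes are parallel to the axes, so whether two of them meet is decided by weak inequalities
  between equally named coordinates of the vertices. Say that the order of \<open>w\<close> refines that of
  \<open>v\<close> if every weak inequality between coordinates of \<open>w\<close> also holds for \<open>v\<close>. Then a singular
  curve \<open>w\<close> forces every \<open>v\<close> whose order it refines to be singular (\<open>singular_curve_refines\<close>).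
  Read backwards: around a knot \<open>v\<close>, all curves with a finer order are knots. They also form a
  convex set, so straight segments between them are paths of knots. Three facts result.

  First, each knot is joined by a segment to the representative of a cell that has it in its
  closure; so every component contains a representative.

  Second, the cells with a given knot \<open>v\<close> in their closure are equivalent
  (\<open>refinements_equivalent\<close>). Their permutations sort the coordinates of \<open>v\<close>, and two ways of
  sorting differ by adjacent swaps of tied entries (\<open>sorting_permutations_connected\<close>). The segment
  that realises such a swap joins two curves with orders finer than that of \<open>v\<close>, hence it is an
  elementary geometric isotopy.

  Third, the class attached to \<open>v\<close> in this way is locally constant, because nearby curves have
  finer orders (\<open>refining_neighbourhood\<close>). It is therefore constant on connected sets. This
  avoids any general position argument for paths of knots.
\<close>

section \<open>Presentations identifying generators\<close>

text \<open>
  The kernel of the homomorphism induced by \<open>f\<close> has to be generated by the relators; this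
  follows from choosing one representative in each fibre of \<open>f\<close>.
\<close>

lemma free_Abelian_group_modulo_iso:
  assumes onto: "f ` S = T"
    and R: "\<And>a b. a \<in> S \<Longrightarrow> b \<in> S \<Longrightarrow> R a b \<longleftrightarrow> f a = f b"
  shows "free_Abelian_group T \<cong> free_Abelian_group_modulo S R"
proof -
  define G where "G = free_Abelian_group S"
  define D where "D = {frag_of a - frag_of b | a b. a \<in> S \<and> b \<in> S \<and> R a b}"
  define h where "h = frag_extend (frag_of \<circ> f)"
  have h_of [simp]: "h (frag_of a) = frag_of (f a)" for a
    by (simp add: h_def)
  have h_diff: "h (x - y) = h x - h y" for x y
    by (simp add: h_def frag_extend_diff)
  have h_closed: "Poly_Mapping.keys (h x) \<subseteq> T" if "Poly_Mapping.keys x \<subseteq> S" for x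
    using that keys_frag_extend [of "frag_of \<circ> f" x] onto by (force simp: h_def)
  have hom: "h \<in> hom G (free_Abelian_group T)"
    by (rule homI) (use h_closed in \<open>auto simp: G_def h_def frag_extend_add\<close>)
  interpret group_hom G "free_Abelian_group T" h
    using hom by (simp add: G_def group_hom_def group_hom_axioms_def)
  have h_onto: "h ` carrier G = carrier (free_Abelian_group T)"
  proof
    show "carrier (free_Abelian_group T) \<subseteq> h ` carrier G"
    proof
      fix y assume "y \<in> carrier (free_Abelian_group T)"
      then have "Poly_Mapping.keys y \<subseteq> T" by simp
      then show "y \<in> h ` carrier G"
      proof (induction rule: frag_induction)
        case zero
        show ?case by (rule image_eqI [of _ _ 0]) (auto simp: h_def G_def)
      next
        case (one t)
        then obtain a where "a \<in> S" "f a = t" using onto by blast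
        then show ?case by (intro image_eqI [of _ _ "frag_of a"]) (auto simp: G_def)
      next
        case (diff y z)
        then obtain x x' where "y = h x" "z = h x'" "x \<in> carrier G" "x' \<in> carrier G"
          by blast
        then show ?case
          using keys_diff [of x x']
          by (intro image_eqI [of _ _ "x - x'"]) (auto simp: G_def h_diff)
      qed
    qed
  qed (use hom_closed in blast)
  have D_sub: "D \<subseteq> carrier G"
    using keys_diff by (fastforce simp: D_def G_def)
  have D_kernel: "D \<subseteq> kernel G (free_Abelian_group T) h"
    using D_sub by (auto simp: kernel_def D_def h_diff R)
  have gen_diff: "x - y \<in> generate G D" if "x \<in> generate G D" "y \<in> generate G D" for x y
  proof -
    have y: "y \<in> carrier G"
      using that G.generate_in_carrier [OF D_sub] by blast
    then have "inv\<^bsub>G\<^esub> y = - y" by (simp add: G_def)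
    then have "- y \<in> generate G D"
      using G.generate_m_inv_closed [OF D_sub that(2)] by simp
    then have "x \<otimes>\<^bsub>G\<^esub> (- y) \<in> generate G D"
      using that(1) by (rule generate.eng [rotated])
    then show ?thesis by (simp add: G_def)
  qed
  have gen_0: "0 \<in> generate G D"
    using generate.one [of G D] by (simp add: G_def)
  (* Modulo the relators, every element agrees with an element that depends on its image
     under h only; for an element of the kernel the latter is 0. *)
  define g where "g = inv_into S f"
  have fold_in: "x - frag_extend (frag_of \<circ> g) (h x) \<in> generate G D"
    if "Poly_Mapping.keys x \<subseteq> S" for x
    using that
  proof (induction rule: frag_induction)
    case zero
    then show ?case using gen_0 by (simp add: h_def)
  next
    case (one a)
    have "g (f a) \<in> S" "f (g (f a)) = f a"
      using one by (auto simp: g_def inv_into_into f_inv_into_f)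
    then have "R a (g (f a))" using R one by simp
    then have "frag_of a - frag_of (g (f a)) \<in> D"
      using one \<open>g (f a) \<in> S\<close> unfolding D_def by blast
    then show ?case by (simp add: generate.incl)
  next
    case (diff a b)
    from gen_diff [OF this] show ?case
      by (simp add: h_diff frag_extend_diff algebra_simps)
  qed
  have "kernel G (free_Abelian_group T) h = generate G D"
  proof
    show "kernel G (free_Abelian_group T) h \<subseteq> generate G D"
    proof
      fix x assume "x \<in> kernel G (free_Abelian_group T) h"
      then have "Poly_Mapping.keys x \<subseteq> S" "h x = 0" by (auto simp: kernel_def G_def)
      then show "x \<in> generate G D" using fold_in [of x] by simp
    qed
    show "generate G D \<subseteq> kernel G (free_Abelian_group T) h"
      using G.generate_subgroup_incl [OF D_kernel subgroup_kernel] .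
  qed
  then have eq: "free_Abelian_group_modulo S R = G Mod kernel G (free_Abelian_group T) h"
    by (simp add: free_Abelian_group_modulo_def G_def D_def)
  have "G Mod kernel G (free_Abelian_group T) h \<cong> free_Abelian_group T"
    using FactGroup_iso h_onto by blast
  moreover have "group (G Mod kernel G (free_Abelian_group T) h)"
    by (rule normal.factorgroup_is_group [OF normal_kernel])
  ultimately show ?thesis
    unfolding eq by (rule group.iso_sym [rotated])
qed


section \<open>Sorting by adjacent swaps\<close>

lemma strict_mono_permutation_eq_id:
  fixes q :: "nat \<Rightarrow> nat"
  assumes q: "q permutes {1..<n}" and mono: "strict_mono_on {1..<n} q"
  shows "q = id"
proof -
  have ge: "i \<le> q i" if "i \<in> {1..<n}" for i
    using that
  proof (induction i)
    case (Suc i)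
    have "Suc i \<le> q (Suc i)" if "i = 0"
      using permutes_in_image [OF q, of "Suc i"] Suc.prems that by simp
    moreover have "Suc i \<le> q (Suc i)" if "i \<noteq> 0"
      using Suc that strict_mono_onD [OF mono, of i "Suc i"] by fastforce
    ultimately show ?case by blast
  qed simp
  have "q i = i" if "i \<in> {1..<n}" for i
  proof (rule ccontr)
    assume "q i \<noteq> i"
    with ge that have "\<exists>i\<in>{1..<n}. i < q i" by (metis nat_less_le)
    then have "(\<Sum>i\<in>{1..<n}. i) < (\<Sum>i\<in>{1..<n}. q i)"
      using ge by (intro sum_strict_mono_ex1) auto
    then show False using sum.permute [OF q, of id] by (simp add: comp_def)
  qed
  then show ?thesis
    using permutes_not_in [OF q] by (metis eq_id_iff)
qed

text \<open>
  The list of indices is sorted by value; the shifts by one come from list positions starting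
  at 0.
\<close>

lemma ex_sorting_permutation:
  fixes f :: "nat \<Rightarrow> real"
  obtains s where "s permutes {1..<n}" "mono_on {1..<n} (f \<circ> s)"
proof -
  define xs where "xs = sort_key f [1..<n]"
  have len: "length xs = n - 1" and set: "set xs = {1..<n}" and dist: "distinct xs"
    by (auto simp: xs_def)
  define s where "s i = (if i \<in> {1..<n} then xs ! (i - 1) else i)" for i
  have "inj_on s {1..<n}"
  proof (rule inj_onI)
    fix i j assume ij: "i \<in> {1..<n}" "j \<in> {1..<n}" and "s i = s j"
    then have "i - 1 = j - 1"
      using nth_eq_iff_index_eq [OF dist, of "i - 1" "j - 1"] len by (auto simp: s_def)
    then show "i = j" using ij by auto
  qed
  moreover have "s ` {1..<n} \<subseteq> {1..<n}"
  proof
    fix y assume "y \<in> s ` {1..<n}"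
    then obtain i where "i \<in> {1..<n}" "y = xs ! (i - 1)" by (auto simp: s_def)
    then have "y \<in> set xs" using len by (auto intro!: nth_mem)
    then show "y \<in> {1..<n}" using set by simp
  qed
  ultimately have "bij_betw s {1..<n} {1..<n}"
    by (simp add: bij_betw_def endo_inj_surj)
  then have "s permutes {1..<n}"
    by (rule bij_imp_permutes) (auto simp: s_def)
  moreover have "mono_on {1..<n} (f \<circ> s)"
  proof (rule mono_onI)
    fix i j assume ij: "i \<in> {1..<n}" "j \<in> {1..<n}" "i \<le> j"
    have "sorted (map f xs)" by (simp add: xs_def)
    moreover have "i - 1 \<le> j - 1" "j - 1 < length (map f xs)" using ij len by auto
    ultimately have "map f xs ! (i - 1) \<le> map f xs ! (j - 1)"
      by (rule sorted_nth_mono)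
    then show "(f \<circ> s) i \<le> (f \<circ> s) j" using ij len by (auto simp: s_def)
  qed
  ultimately show thesis by (rule that)
qed

text \<open>
  One swap of neighbouring entries with both arrangements sorted, so that the swapped entries
  have equal values under \<open>f\<close>.
\<close>

definition sorted_swap :: "nat \<Rightarrow> (nat \<Rightarrow> real) \<Rightarrow> (nat \<Rightarrow> nat) \<Rightarrow> (nat \<Rightarrow> nat) \<Rightarrow> bool" where
  "sorted_swap n f s t \<longleftrightarrow>
     s permutes {1..<n} \<and> t permutes {1..<n} \<and>
     mono_on {1..<n} (f \<circ> s) \<and> mono_on {1..<n} (f \<circ> t) \<and>
     (\<exists>\<tau>. appears_in n \<tau> s \<and> t = \<tau> \<circ> s)"

text \<open>
  Bubble sort: if two neighbouring entries of \<open>s\<close> stand in the opposite order in \<open>t\<close>, then both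
  sortings together force a tie between them, and the swap keeps the arrangement sorted. The
  weighted sum of target positions decreases, since a swap moves the larger target position to
  the place with the smaller weight.
\<close>

lemma sorting_permutations_connected:
  fixes f :: "nat \<Rightarrow> real"
  assumes "s permutes {1..<n}" "mono_on {1..<n} (f \<circ> s)"
    and t: "t permutes {1..<n}" and ft: "mono_on {1..<n} (f \<circ> t)"
  shows "(sorted_swap n f)\<^sup>*\<^sup>* s t"
  using assms(1,2)
proof (induction "\<Sum>i\<in>{1..<n}. (n - i) * inv_into UNIV t (s i)" arbitrary: s rule: less_induct)
  case less
  note s = \<open>s permutes {1..<n}\<close> and fs = \<open>mono_on {1..<n} (f \<circ> s)\<close>
  let ?q = "inv_into UNIV t \<circ> s"
  have q: "?q permutes {1..<n}"
    using permutes_compose [OF s permutes_inv [OF t]] .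
  have t_q: "t (?q i) = s i" for i
    using permutes_inverses [OF t] by simp
  show ?case
  proof (cases "\<exists>k\<in>{1..n - 2}. ?q (k + 1) < ?q k")
    case True
    then obtain k where k: "k \<in> {1..n - 2}" and inversion: "?q (k + 1) < ?q k" by blast
    then have kI: "k \<in> {1..<n}" "k + 1 \<in> {1..<n}" by auto
    define \<tau> where "\<tau> = Transposition.transpose (s k) (s (k + 1))"
    have sI: "s k \<in> {1..<n}" "s (k + 1) \<in> {1..<n}"
      using kI permutes_in_image [OF s] by blast+
    have s': "\<tau> \<circ> s permutes {1..<n}"
      unfolding \<tau>_def using s permutes_swap_id [OF sI] by (rule permutes_compose)
    have "f (s (k + 1)) \<le> f (s k)"
      using mono_onD [OF ft, of "?q (k + 1)" "?q k"] inversion kI permutes_in_image [OF q]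
      by (simp only: comp_def t_q [unfolded comp_def])
    moreover have "f (s k) \<le> f (s (k + 1))"
      using mono_onD [OF fs, of k "k + 1"] kI by simp
    ultimately have tie: "f (s k) = f (s (k + 1))" by simp
    have "f \<circ> (\<tau> \<circ> s) = f \<circ> s"
    proof
      fix i show "(f \<circ> (\<tau> \<circ> s)) i = (f \<circ> s) i"
        using tie by (cases "s i = s k"; cases "s i = s (k + 1)")
          (auto simp: \<tau>_def)
    qed
    then have fs': "mono_on {1..<n} (f \<circ> (\<tau> \<circ> s))"
      using fs by simp
    have step: "sorted_swap n f s (\<tau> \<circ> s)"
      unfolding sorted_swap_def appears_in_def using s s' fs fs' k \<tau>_def by blast
    have inj: "s i = s j \<longleftrightarrow> i = j" for i j
      using permutes_inj [OF s] by (auto dest: injD)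
    have rest: "(\<tau> \<circ> s) i = s i" if "i \<notin> {k, k + 1}" for i
      using that by (simp add: \<tau>_def inj)
    have split: "(\<Sum>i\<in>{1..<n}. h i) = h k + h (k + 1) + (\<Sum>i\<in>{1..<n} - {k, k + 1}. h i)"
      for h :: "nat \<Rightarrow> nat"
    proof -
      have "(\<Sum>i\<in>{1..<n}. h i) = (\<Sum>i\<in>{k, k + 1}. h i) + (\<Sum>i\<in>{1..<n} - {k, k + 1}. h i)"
        using sum.subset_diff [of "{k, k + 1}" "{1..<n}" h] kI by (simp only: add.commute) auto
      then show ?thesis by simp
    qed
    have "(n - k) * ?q (k + 1) + (n - (k + 1)) * ?q k < (n - k) * ?q k + (n - (k + 1)) * ?q (k + 1)"
    proof -
      obtain m where m: "n - k = Suc m" "n - (k + 1) = m"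
        using kI by (metis Suc_diff_Suc Suc_eq_plus1 atLeastLessThan_iff)
      show ?thesis unfolding m using inversion by simp
    qed
    then have "(\<Sum>i\<in>{1..<n}. (n - i) * inv_into UNIV t ((\<tau> \<circ> s) i))
        < (\<Sum>i\<in>{1..<n}. (n - i) * inv_into UNIV t (s i))"
      unfolding split using rest by (simp add: \<tau>_def)
    from step less.hyps [OF this s' fs'] show ?thesis
      by (rule converse_rtranclp_into_rtranclp)
  next
    case False
    have ascent: "?q k < ?q (Suc k)" if "1 \<le> k" "Suc k < n" for k
    proof -
      have "k \<in> {1..n - 2}" using that by auto
      then have "\<not> ?q (k + 1) < ?q k" using False by blast
      moreover have "?q k \<noteq> ?q (Suc k)"
        using permutes_inj [OF q] by (metis injD n_not_Suc_n)
      ultimately show ?thesis by simp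
    qed
    have "strict_mono_on {1..<n} ?q"
    proof (rule strict_mono_onI)
      fix i j assume ij: "i \<in> {1..<n}" "j \<in> {1..<n}" "i < j"
      have "Suc i \<le> j" using ij by simp
      then have "j < n \<longrightarrow> ?q i < ?q j"
      proof (induction j rule: dec_induct)
        case base
        show ?case using ascent [of i] ij by simp
      next
        case (step m)
        then show ?case using ascent [of m] ij by fastforce
      qed
      then show "?q i < ?q j" using ij by simp
    qed
    then have "?q = id" using strict_mono_permutation_eq_id q by blast
    then have "s = t" using t_q by (metis ext id_apply)
    then show ?thesis by simp
  qed
qed


section \<open>Singularity depends on the order of the coordinates\<close>

text \<open>
  For curves this says that \<open>v\<close> lies in the closure of the set of curves whose coordinates are ordered, with
  the same ties, as those of \<open>w\<close>.
\<close>

definition order_refines :: "nat \<Rightarrow> (nat \<Rightarrow> real ^ 3) \<Rightarrow> (nat \<Rightarrow> real ^ 3) \<Rightarrow> bool" where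
  "order_refines n w v \<longleftrightarrow>
     (\<forall>c. \<forall>i\<in>{1..<n}. \<forall>j\<in>{1..<n}. w i $ c \<le> w j $ c \<longrightarrow> v i $ c \<le> v j $ c)"

lemma order_refinesD:
  "order_refines n w v \<Longrightarrow> i \<in> {1..<n} \<Longrightarrow> j \<in> {1..<n} \<Longrightarrow> w i $ c \<le> w j $ c \<Longrightarrow> v i $ c \<le> v j $ c"
  by (simp add: order_refines_def)

lemma order_refines_refl: "order_refines n v v"
  by (simp add: order_refines_def)

lemma order_refines_trans: "order_refines n u w \<Longrightarrow> order_refines n w v \<Longrightarrow> order_refines n u v"
  unfolding order_refines_def by blast

lemma topspace_plumbers_curve_space:
  "topspace (plumbers_curve_space n) = {1..<n} \<rightarrow>\<^sub>E open_unit_cube"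
  by (simp add: plumbers_curve_space_def)

lemma topspace_plumbers_knot_space:
  "v \<in> topspace (plumbers_knot_space n) \<longleftrightarrow>
     v \<in> topspace (plumbers_curve_space n) \<and> \<not> singular_curve n v"
  by (auto simp: plumbers_knot_space_def)

lemma curve_coordinate_bounds:
  assumes "v \<in> topspace (plumbers_curve_space n)" "i \<in> {1..<n}"
  shows "0 < v i $ c" "v i $ c < 1"
  using assms by (auto simp: topspace_plumbers_curve_space open_unit_cube_def PiE_iff)

text \<open>
  The fixed end vertices do not disturb the comparison, as their coordinates are the strict
  bounds 0 and 1 of all the others.
\<close>

lemma order_refines_vertex:
  assumes w: "w \<in> topspace (plumbers_curve_space n)"
    and v: "v \<in> topspace (plumbers_curve_space n)"
    and ref: "order_refines n w v"
    and ij: "i \<le> n" "j \<le> n" "vertex n w i $ c \<le> vertex n w j $ c"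
  shows "vertex n v i $ c \<le> vertex n v j $ c"
proof -
  have ends: "vector [0, 0, 0] $ c = (0::real)" "vector [1, 1, 1] $ c = (1::real)"
    using exhaust_3 [of c] by auto
  have cases: "k = 0 \<or> k = n \<or> k \<in> {1..<n}" if "k \<le> n" for k
    using that by auto
  note bw = curve_coordinate_bounds [OF w, of _ c] and bv = curve_coordinate_bounds [OF v, of _ c]
  show ?thesis
    using cases [OF ij(1)] cases [OF ij(2)] ij(3) order_refinesD [OF ref, of i j c]
      bw [of i] bw [of j] bv [of i] bv [of j]
    by (auto simp: vertex_def ends split: if_splits)
qed

lemma closed_segment_axis_parallel:
  fixes p q :: "real ^ 'n"
  assumes "\<forall>d. d \<noteq> c \<longrightarrow> p $ d = q $ d"
  shows "closed_segment p q = {x. \<forall>d. x $ d \<in> closed_segment (p $ d) (q $ d)}"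
proof (intro equalityI subsetI)
  fix x assume "x \<in> closed_segment p q"
  then show "x \<in> {x. \<forall>d. x $ d \<in> closed_segment (p $ d) (q $ d)}"
    by (auto simp: closed_segment_def)
next
  fix x assume "x \<in> {x. \<forall>d. x $ d \<in> closed_segment (p $ d) (q $ d)}"
  then have x: "x $ d \<in> closed_segment (p $ d) (q $ d)" for d by simp
  from x [of c] obtain u where u: "0 \<le> u" "u \<le> 1" "x $ c = (1 - u) * p $ c + u * q $ c"
    by (auto simp: closed_segment_def)
  have "x = (1 - u) *\<^sub>R p + u *\<^sub>R q"
  proof (subst vec_eq_iff, intro allI)
    fix d show "x $ d = ((1 - u) *\<^sub>R p + u *\<^sub>R q) $ d"
      using u(3) x [of d] assms by (cases "d = c") (auto simp: algebra_simps)
  qed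
  then show "x \<in> closed_segment p q" using u by (auto simp: closed_segment_def)
qed

text \<open>
  The curve passes from pipe \<open>k - 1\<close> to pipe \<open>k\<close> at a corner whose coordinate \<open>c\<close> is taken from
  the vertex with this index: vertex \<open>i + 1\<close> takes over coordinate 1 after pipe \<open>3 * i\<close>, and
  coordinates 2 and 3 one and two pipes later.
\<close>

definition corner_index :: "nat \<Rightarrow> 3 \<Rightarrow> nat" where
  "corner_index k c = (k + (if c = 1 then 2 else if c = 2 then 1 else 0)) div 3"

lemma corner_index_le: "k \<le> 3 * n \<Longrightarrow> corner_index k c \<le> n"
  by (auto simp: corner_index_def)

lemma pipe_box:
  "path_image (pipe n v k) =
     {x. \<forall>c. x $ c \<in> closed_segment (vertex n v (corner_index k c) $ c)
                                  (vertex n v (corner_index (k + 1) c) $ c)}"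
proof -
  define i where "i = k div 3"
  have distinct3: "(1::3) \<noteq> 2" "(1::3) \<noteq> 3" "(2::3) \<noteq> 3" "(2::3) \<noteq> 1" "(3::3) \<noteq> 1" "(3::3) \<noteq> 2"
    by simp_all
  consider "k = 3 * i" | "k = 3 * i + 1" | "k = 3 * i + 2"
    unfolding i_def by linarith
  then show ?thesis
  proof cases
    case 1
    have c: "corner_index k 1 = i" "corner_index k 2 = i" "corner_index k 3 = i"
      "corner_index (k + 1) 1 = i + 1" "corner_index (k + 1) 2 = i" "corner_index (k + 1) 3 = i"
      unfolding 1 by (simp_all add: corner_index_def distinct3)
    have m: "k mod 3 = 0" unfolding 1 by simp
    show ?thesis
      unfolding pipe_def m x_pipe_def Let_def i_def [symmetric]
      by (simp del: One_nat_def add_Suc_right, subst closed_segment_axis_parallel [of 1])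
        (auto simp: forall_3 distinct3 c simp del: One_nat_def add_Suc_right)
  next
    case 2
    have c: "corner_index k 1 = i + 1" "corner_index k 2 = i" "corner_index k 3 = i"
      "corner_index (k + 1) 1 = i + 1" "corner_index (k + 1) 2 = i + 1" "corner_index (k + 1) 3 = i"
      unfolding 2 by (simp_all add: corner_index_def distinct3)
    have m: "k mod 3 = 1" unfolding 2 by simp
    show ?thesis
      unfolding pipe_def m y_pipe_def Let_def i_def [symmetric]
      by (simp del: One_nat_def add_Suc_right, subst closed_segment_axis_parallel [of 2])
        (auto simp: forall_3 distinct3 c simp del: One_nat_def add_Suc_right)
  next
    case 3
    have c: "corner_index k 1 = i + 1" "corner_index k 2 = i + 1" "corner_index k 3 = i"
      "corner_index (k + 1) 1 = i + 1" "corner_index (k + 1) 2 = i + 1" "corner_index (k + 1) 3 = i + 1"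
      unfolding 3 by (simp_all add: corner_index_def distinct3)
    have m: "k mod 3 = 2" unfolding 3 by presburger
    show ?thesis
      unfolding pipe_def m z_pipe_def Let_def i_def [symmetric]
      by (simp del: One_nat_def add_Suc_right, subst closed_segment_axis_parallel [of 3])
        (auto simp: forall_3 distinct3 c simp del: One_nat_def add_Suc_right)
  qed
qed

text \<open>
  The larger of the two lower ends is a common point. That it is an end point makes the
  intersection of two pipes a matter of comparing vertex coordinates.
\<close>

lemma closed_segments_meet_at_endpoint:
  fixes x :: real
  assumes "x \<in> closed_segment a b" "x \<in> closed_segment a' b'"
  obtains m where "m \<in> {a, b, a', b'}" "m \<in> closed_segment a b" "m \<in> closed_segment a' b'"
proof -
  have seg: "y \<in> closed_segment r s \<longleftrightarrow> min r s \<le> y \<and> y \<le> max r s" for y r s :: real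
    by (auto simp: closed_segment_eq_real_ivl)
  define m where "m = max (min a b) (min a' b')"
  have "m \<in> {a, b, a', b'}"
    by (auto simp: m_def max_def min_def)
  moreover have "m \<le> x" "min a b \<le> m" "min a' b' \<le> m"
    using assms by (auto simp: m_def seg)
  ultimately show thesis
    using that assms by (meson seg order_trans)
qed

text \<open>
  A common point of two pipes can be chosen with vertex coordinates. Its coordinates are then
  pinned down by weak inequalities, and these pass from \<open>w\<close> to \<open>v\<close>.
\<close>

lemma singular_curve_refines:
  assumes w: "w \<in> topspace (plumbers_curve_space n)"
    and v: "v \<in> topspace (plumbers_curve_space n)"
    and ref: "order_refines n w v" and sing: "singular_curve n w"
  shows "singular_curve n v"
proof -
  obtain j k p where jk: "j < 3 * n" "k < 3 * n" "distant j k"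
    and p: "p \<in> path_image (pipe n w j)" "p \<in> path_image (pipe n w k)"
    using sing by (auto simp: singular_curve_def)
  let ?a = "corner_index j" and ?b = "corner_index (j + 1)"
  let ?a' = "corner_index k" and ?b' = "corner_index (k + 1)"
  have le: "?a c \<le> n" "?b c \<le> n" "?a' c \<le> n" "?b' c \<le> n" for c
    using jk by (simp_all add: corner_index_le)
  have seg: "vertex n v m $ c \<in> closed_segment (vertex n v i $ c) (vertex n v l $ c)"
    if "vertex n w m $ c \<in> closed_segment (vertex n w i $ c) (vertex n w l $ c)"
      "m \<le> n" "i \<le> n" "l \<le> n" for m i l c
    using that order_refines_vertex [OF w v ref, of i m c] order_refines_vertex [OF w v ref, of m i c]
      order_refines_vertex [OF w v ref, of l m c] order_refines_vertex [OF w v ref, of m l c]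
    by (auto simp: closed_segment_eq_real_ivl split: if_splits)
  have "\<exists>m. m \<le> n \<and>
      vertex n v m $ c \<in> closed_segment (vertex n v (?a c) $ c) (vertex n v (?b c) $ c) \<and>
      vertex n v m $ c \<in> closed_segment (vertex n v (?a' c) $ c) (vertex n v (?b' c) $ c)" for c
  proof -
    have "p $ c \<in> closed_segment (vertex n w (?a c) $ c) (vertex n w (?b c) $ c)"
      "p $ c \<in> closed_segment (vertex n w (?a' c) $ c) (vertex n w (?b' c) $ c)"
      using p by (auto simp: pipe_box)
    then obtain y where y: "y \<in> {vertex n w (?a c) $ c, vertex n w (?b c) $ c,
          vertex n w (?a' c) $ c, vertex n w (?b' c) $ c}"
      "y \<in> closed_segment (vertex n w (?a c) $ c) (vertex n w (?b c) $ c)"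
      "y \<in> closed_segment (vertex n w (?a' c) $ c) (vertex n w (?b' c) $ c)"
      by (rule closed_segments_meet_at_endpoint)
    then obtain m where "m \<le> n" "y = vertex n w m $ c"
      using le by blast
    then show ?thesis using y(2,3) seg le by blast
  qed
  then obtain m where m:
      "\<And>c. vertex n v (m c) $ c \<in> closed_segment (vertex n v (?a c) $ c) (vertex n v (?b c) $ c)"
      "\<And>c. vertex n v (m c) $ c \<in> closed_segment (vertex n v (?a' c) $ c) (vertex n v (?b' c) $ c)"
    by metis
  let ?x = "\<chi> c. vertex n v (m c) $ c"
  have "?x \<in> path_image (pipe n v j)" "?x \<in> path_image (pipe n v k)"
    unfolding pipe_box using m by auto
  then show ?thesis using jk by (auto simp: singular_curve_def)
qed


text \<open>
  Each pipe moves in a single direction, so some coordinate is constant on both of two given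
  pipes. If the pipes are distant, this coordinate is taken from different vertices.
\<close>

lemma curve_with_distinct_coordinates_nonsingular:
  assumes v: "v \<in> topspace (plumbers_curve_space n)"
    and inj: "\<And>c. inj_on (\<lambda>i. v i $ c) {1..<n}"
  shows "\<not> singular_curve n v"
proof
  have vertex_inj: "i = j"
    if "i \<le> n" "j \<le> n" "vertex n v i $ c = vertex n v j $ c" for i j c
  proof -
    have ends: "vector [0, 0, 0] $ c = (0::real)" "vector [1, 1, 1] $ c = (1::real)"
      using exhaust_3 [of c] by auto
    have cases: "k = 0 \<or> k = n \<or> k \<in> {1..<n}" if "k \<le> n" for k
      using that by auto
    have start: "vertex n v 0 $ c = 0"
      by (simp add: vertex_def ends)
    have finish: "vertex n v n $ c = 1" if "n \<noteq> 0"
      using that by (simp add: vertex_def ends)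
    have inner: "vertex n v k $ c = v k $ c" "0 < vertex n v k $ c" "vertex n v k $ c < 1"
      if "k \<in> {1..<n}" for k
      using that curve_coordinate_bounds [OF v that, of c] by (simp_all add: vertex_def)
    have "i = j" if "i \<in> {1..<n}" "j \<in> {1..<n}"
      using inj_onD [OF inj _ that, of c] inner(1) [OF that(1)] inner(1) [OF that(2)]
        \<open>vertex n v i $ c = vertex n v j $ c\<close> by simp
    then show ?thesis
      using cases [OF that(1)] cases [OF that(2)] that(3) start finish inner(2,3)
      by (metis less_irrefl zero_neq_one)
  qed
  have disjoint: "path_image (pipe n v j) \<inter> path_image (pipe n v k) = {}"
    if "j + 4 \<le> k" "k < 3 * n" for j k
  proof -
    have "\<exists>c. corner_index (j + 1) c = corner_index j c \<and> corner_index (k + 1) c = corner_index k c"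
    proof -
      have moves: "\<exists>d. \<forall>c. c \<noteq> d \<longrightarrow> corner_index (m + 1) c = corner_index m c" for m
      proof -
        consider "m mod 3 = 0" | "m mod 3 = 1" | "m mod 3 = 2" by linarith
        then show ?thesis
        proof cases
          case 1
          show ?thesis
            by (rule exI [of _ 1]) (use 1 in \<open>auto simp: forall_3 corner_index_def, presburger+\<close>)
        next
          case 2
          show ?thesis
            by (rule exI [of _ 2]) (use 2 in \<open>auto simp: forall_3 corner_index_def, presburger+\<close>)
        next
          case 3
          show ?thesis
            by (rule exI [of _ 3]) (use 3 in \<open>auto simp: forall_3 corner_index_def, presburger+\<close>)
        qed
      qed
      obtain d e where d: "\<forall>c. c \<noteq> d \<longrightarrow> corner_index (j + 1) c = corner_index j c"
        and e: "\<forall>c. c \<noteq> e \<longrightarrow> corner_index (k + 1) c = corner_index k c"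
        using moves by metis
      have "card {d, e} < card (UNIV :: 3 set)"
        by (simp add: card_insert_if)
      then have "{d, e} \<noteq> UNIV" by (metis less_irrefl)
      then obtain c where "c \<noteq> d" "c \<noteq> e" by blast
      then show ?thesis using d e by blast
    qed
    then obtain c where c: "corner_index (j + 1) c = corner_index j c"
      "corner_index (k + 1) c = corner_index k c" by blast
    have "corner_index j c < corner_index k c"
    proof -
      have "corner_index (j + 3) c \<le> corner_index k c"
        using that(1) unfolding corner_index_def by (intro div_le_mono) simp
      moreover have "corner_index (j + 3) c = corner_index j c + 1"
        by (auto simp: corner_index_def)
      ultimately show ?thesis by simp
    qed
    then have "vertex n v (corner_index j c) $ c \<noteq> vertex n v (corner_index k c) $ c"
      using vertex_inj [of "corner_index j c" "corner_index k c" c] that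
      by (auto simp: corner_index_le)
    moreover have "p $ c = vertex n v (corner_index j c) $ c" if "p \<in> path_image (pipe n v j)" for p
      using that c unfolding pipe_box by
        (metis (mono_tags, lifting) closed_segment_idem mem_Collect_eq singletonD)
    moreover have "p $ c = vertex n v (corner_index k c) $ c" if "p \<in> path_image (pipe n v k)" for p
      using that c unfolding pipe_box by
        (metis (mono_tags, lifting) closed_segment_idem mem_Collect_eq singletonD)
    ultimately show ?thesis by fastforce
  qed
  assume "singular_curve n v"
  then obtain j k where jk: "j < 3 * n" "k < 3 * n" "distant j k"
    "path_image (pipe n v j) \<inter> path_image (pipe n v k) \<noteq> {}"
    by (auto simp: singular_curve_def)
  from jk(3) have "j + 4 \<le> k \<or> k + 4 \<le> j"
    by (auto simp: distant_def min_def max_def split: if_splits)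
  then show False using disjoint jk by (metis inf_commute)
qed


section \<open>Straight segments in the space of knots\<close>

lemma straight_line_in_curve_space:
  assumes a: "a \<in> topspace (plumbers_curve_space n)"
    and b: "b \<in> topspace (plumbers_curve_space n)" and t: "t \<in> {0..1}"
  shows "straight_line n a b t \<in> topspace (plumbers_curve_space n)"
proof -
  have "convex {0<..<(1::real)}" by simp
  then have "(1 - t) * a i $ c + t * b i $ c \<in> {0<..<1}" if "i \<in> {1..<n}" for i c
    using convexD [of "{0<..<(1::real)}" "a i $ c" "b i $ c" "1 - t" t] t
      curve_coordinate_bounds [OF a that, of c] curve_coordinate_bounds [OF b that, of c]
    by simp
  then show ?thesis
    by (auto simp: topspace_plumbers_curve_space straight_line_def open_unit_cube_def)
qed

text \<open>
  Weak inequalities at a convex combination come from a weak inequality at one of the ends.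
\<close>

lemma straight_line_refines:
  assumes a: "order_refines n a v" and b: "order_refines n b v" and t: "t \<in> {0..1}"
  shows "order_refines n (straight_line n a b t) v"
  unfolding order_refines_def
proof (intro allI ballI impI)
  fix c i j
  assume ij: "i \<in> {1..<n}" "j \<in> {1..<n}"
    and le: "straight_line n a b t i $ c \<le> straight_line n a b t j $ c"
  have "a i $ c \<le> a j $ c \<or> b i $ c \<le> b j $ c"
  proof (rule ccontr)
    assume "\<not> ?thesis"
    then have *: "a j $ c < a i $ c" "b j $ c < b i $ c" by auto
    have "(1 - t) * a j $ c + t * b j $ c < (1 - t) * a i $ c + t * b i $ c"
    proof (cases "t = 0")
      case False
      then show ?thesis
        using * t by (intro add_le_less_mono mult_left_mono mult_strict_left_mono) auto
    qed (use * in simp)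
    then show False using le ij by (simp add: straight_line_def)
  qed
  then show "v i $ c \<le> v j $ c"
    using order_refinesD [OF a ij] order_refinesD [OF b ij] by blast
qed

lemma straight_line_in_knot_space:
  assumes v: "v \<in> topspace (plumbers_knot_space n)"
    and a: "a \<in> topspace (plumbers_curve_space n)" "order_refines n a v"
    and b: "b \<in> topspace (plumbers_curve_space n)" "order_refines n b v"
    and t: "t \<in> {0..1}"
  shows "straight_line n a b t \<in> topspace (plumbers_knot_space n)"
  using v straight_line_in_curve_space [OF a(1) b(1) t] straight_line_refines [OF a(2) b(2) t]
    singular_curve_refines
  by (auto simp: topspace_plumbers_knot_space)

lemma path_component_of_straight_line:
  assumes a: "a \<in> topspace (plumbers_curve_space n)"
    and b: "b \<in> topspace (plumbers_curve_space n)"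
    and line: "\<And>t. t \<in> {0..1} \<Longrightarrow> straight_line n a b t \<in> topspace (plumbers_knot_space n)"
  shows "path_component_of (plumbers_knot_space n) a b"
  unfolding path_component_of_def
proof (intro exI conjI)
  have ext: "a \<in> extensional {1..<n}" "b \<in> extensional {1..<n}"
    using a b by (auto simp: topspace_plumbers_curve_space PiE_def)
  show "straight_line n a b 0 = a" "straight_line n a b 1 = b"
    using ext by (auto simp: straight_line_def extensional_def)
  have "continuous_map (top_of_set {0..1}) (plumbers_curve_space n) (straight_line n a b)"
    unfolding plumbers_curve_space_def continuous_map_componentwise
  proof (intro conjI ballI)
    show "straight_line n a b ` topspace (top_of_set {0..1}) \<subseteq> extensional {1..<n}"
      by (auto simp: straight_line_def)
    fix i assume i: "i \<in> {1..<n}"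
    have "straight_line n a b t i \<in> open_unit_cube" if "t \<in> {0..1}" for t
      using straight_line_in_curve_space [OF a b that] i
      by (auto simp: topspace_plumbers_curve_space)
    moreover have "continuous_on {0..1} (\<lambda>t. straight_line n a b t i)"
      using i by (simp add: straight_line_def) (intro continuous_intros)
    ultimately show "continuous_map (top_of_set {0..1}) (top_of_set open_unit_cube)
        (\<lambda>t. straight_line n a b t i)"
      by auto
  qed
  then show "pathin (plumbers_knot_space n) (straight_line n a b)"
    unfolding pathin_def plumbers_knot_space_def continuous_map_in_subtopology
    using line by (auto simp: topspace_plumbers_knot_space)
qed


section \<open>Cells around a knot\<close>

lemma representative_nth:
  assumes "\<sigma> c permutes {1..<n}" "i \<in> {1..<n}"
  shows "representative n \<sigma> (\<sigma> c i) $ c = real i / real n"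
  using assms permutes_in_image [OF assms(1)] permutes_inverses [OF assms(1)]
  by (simp add: representative_def)

lemma representative_in_curve_space:
  assumes "\<sigma> \<in> perm_triples n"
  shows "representative n \<sigma> \<in> topspace (plumbers_curve_space n)"
proof -
  have inv: "inv_into UNIV (\<sigma> c) permutes {1..<n}" for c
    using assms by (simp add: perm_triples_def permutes_inv)
  have "0 < inv_into UNIV (\<sigma> c) i \<and> inv_into UNIV (\<sigma> c) i < n" if "i \<in> {1..<n}" for c i
    using permutes_in_image [OF inv [of c], of i] that by simp
  then have "0 < real (inv_into UNIV (\<sigma> c) i) / real n \<and> real (inv_into UNIV (\<sigma> c) i) / real n < 1"
    if "i \<in> {1..<n}" for c i
    using that by simp
  then show ?thesis
    by (simp add: topspace_plumbers_curve_space representative_def open_unit_cube_def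
        restrict_PiE_iff)
qed

text \<open>
  The cells whose closure contains \<open>v\<close> are those whose permutations sort the coordinates of \<open>v\<close>.
\<close>

lemma representative_refines_iff:
  assumes \<sigma>: "\<sigma> \<in> perm_triples n"
  shows "order_refines n (representative n \<sigma>) v \<longleftrightarrow> (\<forall>c. mono_on {1..<n} ((\<lambda>i. v i $ c) \<circ> \<sigma> c))"
proof -
  have p: "\<sigma> c permutes {1..<n}" for c
    using \<sigma> by (simp add: perm_triples_def)
  have le_iff: "representative n \<sigma> (\<sigma> c i) $ c \<le> representative n \<sigma> (\<sigma> c j) $ c \<longleftrightarrow> i \<le> j"
    if "i \<in> {1..<n}" "j \<in> {1..<n}" for c i j
    using that by (simp add: representative_nth [where \<sigma> = \<sigma>, OF p] divide_le_cancel)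
  show ?thesis
  proof (intro iffI allI)
    fix c assume ref: "order_refines n (representative n \<sigma>) v"
    show "mono_on {1..<n} ((\<lambda>i. v i $ c) \<circ> \<sigma> c)"
    proof (rule mono_onI)
      fix i j assume ij: "i \<in> {1..<n}" "j \<in> {1..<n}" "i \<le> j"
      then have "\<sigma> c i \<in> {1..<n}" "\<sigma> c j \<in> {1..<n}"
        using permutes_in_image [OF p [of c]] by simp_all
      then show "((\<lambda>i. v i $ c) \<circ> \<sigma> c) i \<le> ((\<lambda>i. v i $ c) \<circ> \<sigma> c) j"
        using order_refinesD [OF ref] le_iff [OF ij(1,2)] ij(3) by simp
    qed
  next
    assume mono: "\<forall>c. mono_on {1..<n} ((\<lambda>i. v i $ c) \<circ> \<sigma> c)"
    show "order_refines n (representative n \<sigma>) v"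
      unfolding order_refines_def
    proof (intro allI ballI impI)
      fix c i j
      assume ij: "i \<in> {1..<n}" "j \<in> {1..<n}"
        and le: "representative n \<sigma> i $ c \<le> representative n \<sigma> j $ c"
      obtain k l where kl: "k \<in> {1..<n}" "l \<in> {1..<n}" "i = \<sigma> c k" "j = \<sigma> c l"
        using ij permutes_image [OF p [of c]] by (metis imageE)
      then have "k \<le> l" using le le_iff by blast
      then show "v i $ c \<le> v j $ c"
        using mono_onD [OF mono [rule_format, of c] kl(1,2)] kl(3,4) by simp
    qed
  qed
qed

text \<open>
  Elementary isotopies relate cells as sets; with this lemma the permutations can be recovered.
\<close>

lemma cell_determines_permutations:
  assumes \<sigma>: "\<sigma> \<in> perm_triples n" and \<rho>: "\<rho> \<in> perm_triples n" and eq: "cell n \<sigma> = cell n \<rho>"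
  shows "\<sigma> = \<rho>"
proof
  fix c
  have p: "\<sigma> c permutes {1..<n}" "\<rho> c permutes {1..<n}" for c
    using \<sigma> \<rho> by (auto simp: perm_triples_def)
  have "representative n \<sigma> \<in> cell n \<sigma>"
    using representative_in_curve_space [OF \<sigma>]
    by (simp add: cell_def strict_mono_on_def monotone_on_def divide_strict_right_mono
        representative_nth [where \<sigma> = \<sigma>, OF p(1)])
  then have mono: "strict_mono_on {1..<n} (\<lambda>i. representative n \<sigma> (\<rho> c i) $ c)"
    unfolding eq by (simp add: cell_def)
  have "strict_mono_on {1..<n} (inv_into UNIV (\<sigma> c) \<circ> \<rho> c)"
  proof (rule strict_mono_onI)
    fix i j assume ij: "i \<in> {1..<n}" "j \<in> {1..<n}" "i < j"
    then have "representative n \<sigma> (\<rho> c i) $ c < representative n \<sigma> (\<rho> c j) $ c"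
      using strict_mono_onD [OF mono] by blast
    then show "(inv_into UNIV (\<sigma> c) \<circ> \<rho> c) i < (inv_into UNIV (\<sigma> c) \<circ> \<rho> c) j"
      using ij permutes_in_image [OF p(2) [of c]]
      by (simp add: representative_def divide_less_cancel)
  qed
  then have "inv_into UNIV (\<sigma> c) \<circ> \<rho> c = id"
    using strict_mono_permutation_eq_id [OF permutes_compose [OF p(2) permutes_inv [OF p(1)]]]
    by simp
  then show "\<sigma> c = \<rho> c"
    using permutes_inverses(1) [OF p(1)] by (metis comp_apply ext id_apply)
qed

lemma ex_refining_representative:
  obtains \<sigma> where "\<sigma> \<in> perm_triples n" "order_refines n (representative n \<sigma>) v"
proof -
  have "\<exists>s. s permutes {1..<n} \<and> mono_on {1..<n} ((\<lambda>i. v i $ c) \<circ> s)" for c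
    using ex_sorting_permutation by metis
  then obtain \<sigma> where "\<And>c. \<sigma> c permutes {1..<n} \<and> mono_on {1..<n} ((\<lambda>i. v i $ c) \<circ> \<sigma> c)"
    by metis
  then show thesis
    using that [of \<sigma>] representative_refines_iff [of \<sigma>] by (simp add: perm_triples_def)
qed

lemma representative_is_knot:
  assumes "\<sigma> \<in> perm_triples n" shows "representative n \<sigma> \<in> topspace (plumbers_knot_space n)"
proof -
  have "inj_on (\<lambda>i. representative n \<sigma> i $ c) {1..<n}" for c
  proof (rule inj_onI)
    fix i j assume ij: "i \<in> {1..<n}" "j \<in> {1..<n}"
      and eq: "representative n \<sigma> i $ c = representative n \<sigma> j $ c"
    have "\<sigma> c permutes {1..<n}" using assms by (simp add: perm_triples_def)
    then have "inj (inv_into UNIV (\<sigma> c))" using permutes_inv permutes_inj by blast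
    moreover have "inv_into UNIV (\<sigma> c) i = inv_into UNIV (\<sigma> c) j"
      using eq ij by (simp add: representative_def)
    ultimately show "i = j" by (rule injD)
  qed
  then show ?thesis
    using representative_in_curve_space [OF assms] curve_with_distinct_coordinates_nonsingular
    by (simp add: topspace_plumbers_knot_space)
qed

text \<open>
  Each swap of tied entries is an elementary geometric isotopy: both representatives have
  orders finer than that of the knot \<open>v\<close>, so the segment between them stays among the knots.
\<close>

lemma same_coordinate_refinements_equivalent:
  assumes v: "v \<in> topspace (plumbers_knot_space n)"
    and \<sigma>: "\<sigma> \<in> perm_triples n" "order_refines n (representative n \<sigma>) v"
    and s: "s permutes {1..<n}" "mono_on {1..<n} ((\<lambda>i. v i $ c) \<circ> s)"
  shows "equivclp (elementary_isotopic n) (cell n \<sigma>) (cell n (\<sigma>(c := s)))"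
proof -
  let ?f = "\<lambda>i. v i $ c"
  have mono: "mono_on {1..<n} ((\<lambda>i. v i $ d) \<circ> \<sigma> d)" and p: "\<sigma> d permutes {1..<n}" for d
    using \<sigma> by (auto simp: representative_refines_iff [OF \<sigma>(1)] perm_triples_def)
  have "(sorted_swap n ?f)\<^sup>*\<^sup>* (\<sigma> c) s"
    using sorting_permutations_connected [OF p mono s] .
  then show ?thesis
  proof (induction rule: rtranclp_induct)
    case (step s t)
    from step.hyps(2) obtain \<tau> where t: "t = \<tau> \<circ> s" "appears_in n \<tau> s"
      and sorted: "s permutes {1..<n}" "t permutes {1..<n}"
        "mono_on {1..<n} (?f \<circ> s)" "mono_on {1..<n} (?f \<circ> t)"
      by (auto simp: sorted_swap_def)
    let ?\<rho> = "\<sigma>(c := s)" and ?\<rho>' = "\<sigma>(c := t)"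
    have triples: "?\<rho> \<in> perm_triples n" "?\<rho>' \<in> perm_triples n"
      using p sorted by (auto simp: perm_triples_def)
    have ref: "order_refines n (representative n ?\<rho>) v" "order_refines n (representative n ?\<rho>') v"
      using mono sorted by (auto simp: representative_refines_iff [OF triples(1)]
          representative_refines_iff [OF triples(2)])
    have upd: "?\<rho>' = ?\<rho>(c := \<tau> \<circ> ?\<rho> c)" by (simp add: t)
    have "elementary_isotopic n (cell n ?\<rho>) (cell n ?\<rho>')"
      unfolding elementary_isotopic_def
    proof (rule bexI [of _ ?\<rho>], rule exI [of _ c], rule exI [of _ \<tau>], intro conjI ballI)
      show "appears_in n \<tau> (?\<rho> c)" using t by simp
      show "cell n ?\<rho>' = cell n (?\<rho>(c := \<tau> \<circ> ?\<rho> c))" using upd by simp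
      show "straight_line n (representative n ?\<rho>) (representative n (?\<rho>(c := \<tau> \<circ> ?\<rho> c))) r
              \<in> topspace (plumbers_knot_space n)" if "r \<in> {0..1}" for r
        unfolding upd [symmetric]
        using straight_line_in_knot_space [OF v _ ref(1) _ ref(2) that]
          representative_in_curve_space triples by blast
    qed (use triples in auto)
    then show ?case
      using step.IH by (meson equivclp_trans r_into_equivclp)
  qed simp
qed

text \<open>
  The three coordinates are independent of each other and can be rearranged one at a time.
\<close>

lemma refinements_equivalent:
  assumes v: "v \<in> topspace (plumbers_knot_space n)"
    and \<sigma>: "\<sigma> \<in> perm_triples n" "order_refines n (representative n \<sigma>) v"
    and \<rho>: "\<rho> \<in> perm_triples n" "order_refines n (representative n \<rho>) v"
  shows "equivclp (elementary_isotopic n) (cell n \<sigma>) (cell n \<rho>)"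
proof -
  have sorted: "\<rho> c permutes {1..<n}" "mono_on {1..<n} ((\<lambda>i. v i $ c) \<circ> \<rho> c)" for c
    using \<rho> by (auto simp: representative_refines_iff [OF \<rho>(1)] perm_triples_def)
  have upd: "\<theta>(c := \<rho> c) \<in> perm_triples n" "order_refines n (representative n (\<theta>(c := \<rho> c))) v"
      "equivclp (elementary_isotopic n) (cell n \<theta>) (cell n (\<theta>(c := \<rho> c)))"
    if \<theta>: "\<theta> \<in> perm_triples n" "order_refines n (representative n \<theta>) v" for \<theta> c
  proof -
    show *: "\<theta>(c := \<rho> c) \<in> perm_triples n"
      using \<theta>(1) sorted by (simp add: perm_triples_def)
    show "order_refines n (representative n (\<theta>(c := \<rho> c))) v"
      using \<theta>(2) sorted
      by (auto simp: representative_refines_iff [OF *] representative_refines_iff [OF \<theta>(1)])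
    show "equivclp (elementary_isotopic n) (cell n \<theta>) (cell n (\<theta>(c := \<rho> c)))"
      by (rule same_coordinate_refinements_equivalent [OF v \<theta> sorted])
  qed
  define \<sigma>1 where "\<sigma>1 = \<sigma>(1 := \<rho> 1)"
  define \<sigma>2 where "\<sigma>2 = \<sigma>1(2 := \<rho> 2)"
  have "\<sigma>2(3 := \<rho> 3) = \<rho>"
  proof
    fix c show "(\<sigma>2(3 := \<rho> 3)) c = \<rho> c"
      using exhaust_3 [of c] by (auto simp: \<sigma>1_def \<sigma>2_def)
  qed
  moreover note 1 = upd [OF \<sigma>, of 1, folded \<sigma>1_def]
  moreover note 2 = upd [OF 1(1,2), of 2, folded \<sigma>2_def]
  moreover note upd [OF 2(1,2), of 3]
  ultimately show ?thesis by (metis equivclp_trans)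
qed


section \<open>Path components\<close>

text \<open>
  The finitely many strict inequalities between coordinates of \<open>v\<close> persist nearby.
\<close>

lemma refining_neighbourhood:
  assumes v: "v \<in> topspace (plumbers_curve_space n)"
  obtains N where "openin (plumbers_curve_space n) N" "v \<in> N" "\<And>w. w \<in> N \<Longrightarrow> order_refines n w v"
proof -
  let ?P = "plumbers_curve_space n"
  define F where "F = {(c, i, j). i \<in> {1..<n} \<and> j \<in> {1..<n} \<and> v i $ c < v j $ c}"
  define U where "U = (\<lambda>(c, i, j). {w \<in> topspace ?P. 0 < w j $ c - w i $ c})"
  have "finite F"
    by (rule finite_subset [of _ "UNIV \<times> {1..<n} \<times> {1..<n}"]) (auto simp: F_def)
  have coord: "continuous_map ?P euclideanreal (\<lambda>w. w i $ c)" if "i \<in> {1..<n}" for i c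
  proof -
    have "continuous_map ?P (top_of_set open_unit_cube) (\<lambda>w. w i)"
      unfolding plumbers_curve_space_def using that by (rule continuous_map_product_projection)
    then have "continuous_map ?P euclidean (\<lambda>w. w i)"
      by (rule continuous_map_into_fulltopology)
    moreover have "continuous_map euclidean euclideanreal (\<lambda>x::real ^ 3. x $ c)"
      by (simp add: linear_continuous_on bounded_linear_vec_nth)
    ultimately have "continuous_map ?P euclideanreal ((\<lambda>x. x $ c) \<circ> (\<lambda>w. w i))"
      by (rule continuous_map_compose)
    then show ?thesis by (simp add: comp_def)
  qed
  have "openin ?P (U x)" if x: "x \<in> F" for x
  proof -
    obtain c i j where x_def: "x = (c, i, j)" and ij: "i \<in> {1..<n}" "j \<in> {1..<n}"
      using x by (auto simp: F_def)
    have "continuous_map ?P euclideanreal (\<lambda>w. w j $ c - w i $ c)"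
      using coord ij by (intro continuous_map_diff)
    from openin_continuous_map_preimage [OF this, of "{0<..}"] show ?thesis
      by (simp add: U_def x_def)
  qed
  then have "openin ?P ((\<Inter>x\<in>F. U x) \<inter> topspace ?P)"
    using \<open>finite F\<close> by (intro openin_INT) auto
  moreover have "v \<in> (\<Inter>x\<in>F. U x) \<inter> topspace ?P"
    using v by (auto simp: U_def F_def)
  moreover have "order_refines n w v" if "w \<in> (\<Inter>x\<in>F. U x) \<inter> topspace ?P" for w
    unfolding order_refines_def
  proof (intro allI ballI impI)
    fix c i j assume ij: "i \<in> {1..<n}" "j \<in> {1..<n}" and le: "w i $ c \<le> w j $ c"
    show "v i $ c \<le> v j $ c"
    proof (rule ccontr)
      assume "\<not> v i $ c \<le> v j $ c"
      then have "(c, j, i) \<in> F" using ij by (simp add: F_def)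
      then have "w \<in> U (c, j, i)" using that by blast
      then show False using le by (simp add: U_def)
    qed
  qed
  ultimately show thesis by (rule that)
qed

lemma swap_in_perm_triples:
  assumes \<theta>: "\<theta> \<in> perm_triples n" and ap: "appears_in n \<tau> (\<theta> c)"
  shows "\<theta>(c := \<tau> \<circ> \<theta> c) \<in> perm_triples n"
proof -
  have p: "\<theta> c permutes {1..<n}" using \<theta> by (simp add: perm_triples_def)
  obtain i where i: "i \<in> {1..n - 2}" "\<tau> = Transposition.transpose (\<theta> c i) (\<theta> c (i + 1))"
    using ap by (auto simp: appears_in_def)
  then have "i \<in> {1..<n}" "i + 1 \<in> {1..<n}" by auto
  then have "\<tau> permutes {1..<n}"
    unfolding i(2) using permutes_in_image [OF p] by (intro permutes_swap_id) blast+
  then show ?thesis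
    using \<theta> p permutes_compose by (auto simp: perm_triples_def)
qed

lemma elementary_isotopic_path_component:
  assumes \<sigma>: "\<sigma> \<in> perm_triples n" and \<rho>: "\<rho> \<in> perm_triples n"
    and iso: "elementary_isotopic n (cell n \<sigma>) (cell n \<rho>)"
  shows "path_component_of (plumbers_knot_space n) (representative n \<sigma>) (representative n \<rho>)"
proof -
  obtain \<theta> c \<tau> where \<theta>: "\<theta> \<in> perm_triples n" and ap: "appears_in n \<tau> (\<theta> c)"
    and e: "cell n \<sigma> = cell n \<theta>" "cell n \<rho> = cell n (\<theta>(c := \<tau> \<circ> \<theta> c))"
    and line: "\<And>t. t \<in> {0..1} \<Longrightarrow> straight_line n (representative n \<theta>)
       (representative n (\<theta>(c := \<tau> \<circ> \<theta> c))) t \<in> topspace (plumbers_knot_space n)"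
    using iso unfolding elementary_isotopic_def by blast
  have \<theta>': "\<theta>(c := \<tau> \<circ> \<theta> c) \<in> perm_triples n"
    using \<theta> ap by (rule swap_in_perm_triples)
  have "\<sigma> = \<theta>" "\<rho> = \<theta>(c := \<tau> \<circ> \<theta> c)"
    using cell_determines_permutations \<sigma> \<rho> \<theta> \<theta>' e by blast+
  then show ?thesis
    using path_component_of_straight_line line representative_in_curve_space \<sigma> \<rho> by blast
qed

lemma equivalent_cells_path_component:
  assumes \<sigma>: "\<sigma> \<in> perm_triples n" and \<rho>: "\<rho> \<in> perm_triples n"
    and equiv: "equivclp (elementary_isotopic n) (cell n \<sigma>) (cell n \<rho>)"
  shows "path_component_of (plumbers_knot_space n) (representative n \<sigma>) (representative n \<rho>)"
proof -
  let ?PC = "path_component_of (plumbers_knot_space n)"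
  have cells: "e \<in> cells n \<and> e' \<in> cells n" if step: "elementary_isotopic n e e'" for e e'
  proof -
    obtain \<theta> c \<tau> where \<theta>: "\<theta> \<in> perm_triples n" and ap: "appears_in n \<tau> (\<theta> c)"
      and e: "e = cell n \<theta>" "e' = cell n (\<theta>(c := \<tau> \<circ> \<theta> c))"
      using step unfolding elementary_isotopic_def by blast
    then show ?thesis
      using swap_in_perm_triples by (auto simp: cells_def)
  qed
  from equiv have "\<exists>\<theta>\<in>perm_triples n. cell n \<rho> = cell n \<theta> \<and>
      ?PC (representative n \<sigma>) (representative n \<theta>)"
  proof (induction rule: equivclp_induct)
    case base
    then show ?case
      using \<sigma> representative_is_knot [OF \<sigma>]
      by (intro bexI [of _ \<sigma>]) (simp_all add: path_component_of_refl)
  next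
    case (step y z)
    then obtain \<theta> where \<theta>: "\<theta> \<in> perm_triples n" "y = cell n \<theta>"
      "?PC (representative n \<sigma>) (representative n \<theta>)" by blast
    obtain \<theta>' where \<theta>': "\<theta>' \<in> perm_triples n" "z = cell n \<theta>'"
      using step.hyps(2) cells by (auto simp: cells_def)
    have "?PC (representative n \<theta>) (representative n \<theta>')"
    proof -
      from step.hyps(2) consider "elementary_isotopic n y z" | "elementary_isotopic n z y" by blast
      then show ?thesis
      proof cases
        case 1
        then show ?thesis
          using elementary_isotopic_path_component [OF \<theta>(1) \<theta>'(1)] \<theta>(2) \<theta>'(2) by simp
      next
        case 2
        then show ?thesis
          using elementary_isotopic_path_component [OF \<theta>'(1) \<theta>(1)] \<theta>(2) \<theta>'(2)
          by - (rule path_component_of_sym, simp)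
      qed
    qed
    then show ?case
      using \<theta>'(1,2) path_component_of_trans [OF \<theta>(3)] by blast
  qed
  then show ?thesis using cell_determines_permutations [OF \<rho>] by blast
qed

text \<open>
  The knots near some cell equivalent to \<open>\<sigma>\<close> form an open and closed set, because the class of
  the cells near a knot is locally constant; so a connected set of knots cannot leave it.
\<close>

lemma path_component_equivalent_cells:
  assumes \<sigma>: "\<sigma> \<in> perm_triples n" and \<rho>: "\<rho> \<in> perm_triples n"
    and path: "path_component_of (plumbers_knot_space n) (representative n \<sigma>) (representative n \<rho>)"
  shows "equivclp (elementary_isotopic n) (cell n \<sigma>) (cell n \<rho>)"
proof -
  let ?K = "plumbers_knot_space n"
  define near where
    "near v \<theta> \<longleftrightarrow> \<theta> \<in> perm_triples n \<and> order_refines n (representative n \<theta>) v" for v \<theta>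
  define U where
    "U = {v \<in> topspace ?K. \<exists>\<theta>. near v \<theta> \<and> equivclp (elementary_isotopic n) (cell n \<sigma>) (cell n \<theta>)}"
  have U_iff: "v \<in> U \<longleftrightarrow> equivclp (elementary_isotopic n) (cell n \<sigma>) (cell n \<theta>)"
    if v: "v \<in> topspace ?K" and near: "near v \<theta>" for v \<theta>
  proof
    assume "v \<in> U"
    then obtain \<theta>' where "near v \<theta>'" "equivclp (elementary_isotopic n) (cell n \<sigma>) (cell n \<theta>')"
      by (auto simp: U_def)
    moreover have "equivclp (elementary_isotopic n) (cell n \<theta>') (cell n \<theta>)"
      using refinements_equivalent [OF v] near \<open>near v \<theta>'\<close> by (simp add: near_def)
    ultimately show "equivclp (elementary_isotopic n) (cell n \<sigma>) (cell n \<theta>)"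
      using equivclp_trans by metis
  next
    assume "equivclp (elementary_isotopic n) (cell n \<sigma>) (cell n \<theta>)"
    then show "v \<in> U" using v near by (auto simp: U_def)
  qed
  have locally_constant: "\<exists>N. openin ?K N \<and> v \<in> N \<and> (\<forall>w\<in>N. w \<in> U \<longleftrightarrow> v \<in> U)"
    if v: "v \<in> topspace ?K" for v
  proof -
    obtain N where N: "openin (plumbers_curve_space n) N" "v \<in> N"
      "\<And>w. w \<in> N \<Longrightarrow> order_refines n w v"
      using refining_neighbourhood v by (metis topspace_plumbers_knot_space)
    let ?N = "N \<inter> {v. \<not> singular_curve n v}"
    have N': "openin ?K ?N" "v \<in> ?N"
      using N v by (auto simp: plumbers_knot_space_def openin_subtopology)
    have "w \<in> U \<longleftrightarrow> v \<in> U" if w: "w \<in> ?N" for w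
    proof -
      have wK: "w \<in> topspace ?K" using N'(1) w openin_subset by blast
      obtain \<theta> where "\<theta> \<in> perm_triples n" "order_refines n (representative n \<theta>) w"
        using ex_refining_representative .
      then have near: "near w \<theta>" "near v \<theta>"
        using order_refines_trans [OF _ N(3) [of w]] w by (simp_all add: near_def)
      show ?thesis using U_iff [OF wK near(1)] U_iff [OF v near(2)] by simp
    qed
    then show ?thesis using N' by blast
  qed
  have "openin ?K U"
  proof (subst openin_subopen, intro ballI)
    fix v assume v: "v \<in> U"
    then have "v \<in> topspace ?K" by (simp add: U_def)
    then obtain N where N: "openin ?K N" "v \<in> N" "\<forall>w\<in>N. w \<in> U \<longleftrightarrow> v \<in> U"
      using locally_constant by blast
    then show "\<exists>T. openin ?K T \<and> v \<in> T \<and> T \<subseteq> U" using v by blast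
  qed
  moreover have "openin ?K (topspace ?K - U)"
  proof (subst openin_subopen, intro ballI)
    fix v assume v: "v \<in> topspace ?K - U"
    then obtain N where N: "openin ?K N" "v \<in> N" "\<forall>w\<in>N. w \<in> U \<longleftrightarrow> v \<in> U"
      using locally_constant by blast
    then have "N \<subseteq> topspace ?K - U" using v openin_subset by blast
    then show "\<exists>T. openin ?K T \<and> v \<in> T \<and> T \<subseteq> topspace ?K - U" using N by blast
  qed
  ultimately have clopen: "openin ?K U" "openin ?K (topspace ?K - U)" .
  obtain C where C: "connectedin ?K C" "representative n \<sigma> \<in> C" "representative n \<rho> \<in> C"
    using path_imp_connected_component_of [OF path] by (auto simp: connected_component_of_def)
  have near_rep: "near (representative n \<theta>) \<theta>" if "\<theta> \<in> perm_triples n" for \<theta>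
    using that order_refines_refl by (simp add: near_def)
  have "representative n \<sigma> \<in> U"
    using U_iff [OF representative_is_knot near_rep] \<sigma> by simp
  moreover have "C \<subseteq> U \<union> (topspace ?K - U)"
    using connectedin_subset_topspace [OF C(1)] by blast
  ultimately have "representative n \<rho> \<in> U"
    using connectedinD [OF C(1) clopen] C(2,3) by blast
  then show ?thesis
    using U_iff [OF representative_is_knot near_rep] \<rho> by simp
qed

theorem corollary2p18:
  fixes n :: nat
  assumes "n \<ge> 2"
  shows "homology_group 0 (plumbers_knot_space n) \<cong>
         free_Abelian_group_modulo (cells n) (equivclp (elementary_isotopic n))"
proof -
  let ?K = "plumbers_knot_space n"
  define perms where "perms = inv_into (perm_triples n) (cell n)"
  have perms: "perms (cell n \<sigma>) = \<sigma>" if "\<sigma> \<in> perm_triples n" for \<sigma>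
    unfolding perms_def using that cell_determines_permutations
    by (intro inv_into_f_f inj_onI) blast+
  define f where "f e = path_component_of_set ?K (representative n (perms e))" for e
  have "f ` cells n = path_components_of ?K"
  proof (intro equalityI subsetI)
    fix C assume "C \<in> f ` cells n"
    then show "C \<in> path_components_of ?K"
      using representative_is_knot perms by (auto simp: f_def cells_def path_components_of_def)
  next
    fix C assume "C \<in> path_components_of ?K"
    then obtain v where v: "v \<in> topspace ?K" "C = path_component_of_set ?K v"
      by (auto simp: path_components_of_def)
    obtain \<sigma> where \<sigma>: "\<sigma> \<in> perm_triples n" "order_refines n (representative n \<sigma>) v"
      using ex_refining_representative .
    have vP: "v \<in> topspace (plumbers_curve_space n)"
      using v by (simp add: topspace_plumbers_knot_space)
    have "path_component_of ?K v (representative n \<sigma>)"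
      using path_component_of_straight_line straight_line_in_knot_space [OF v(1)] vP
        order_refines_refl \<sigma> representative_in_curve_space by metis
    then have "path_component_of ?K v = path_component_of ?K (representative n \<sigma>)"
      by (simp add: path_component_of_equiv)
    then have "C = f (cell n \<sigma>)" using v \<sigma> perms by (simp add: f_def)
    then show "C \<in> f ` cells n" using \<sigma> by (auto simp: cells_def)
  qed
  moreover have "equivclp (elementary_isotopic n) a b \<longleftrightarrow> f a = f b"
    if cells: "a \<in> cells n" "b \<in> cells n" for a b
  proof -
    obtain \<sigma> \<rho> where ab: "a = cell n \<sigma>" "b = cell n \<rho>"
      and \<sigma>: "\<sigma> \<in> perm_triples n" and \<rho>: "\<rho> \<in> perm_triples n"
      using cells by (auto simp: cells_def)
    have "f a = f b \<longleftrightarrow> path_component_of ?K (representative n \<sigma>) (representative n \<rho>)"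
      using representative_is_knot [OF \<sigma>] representative_is_knot [OF \<rho>]
      by (simp add: f_def ab perms \<sigma> \<rho> path_component_of_equiv Collect_inj)
         (metis Collect_inj)
    then show ?thesis
      using equivalent_cells_path_component path_component_equivalent_cells \<sigma> \<rho> ab by blast
  qed
  ultimately have "free_Abelian_group (path_components_of ?K) \<cong>
      free_Abelian_group_modulo (cells n) (equivclp (elementary_isotopic n))"
    by (rule free_Abelian_group_modulo_iso)
  with zeroth_homology_group show ?thesis by (rule iso_trans)
qed

end
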